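(* Let $\Delta$ be a non-empty lattice polygon and let \[ S_{1,1}(\Delta) = \{ (a,b) \in \mathbb{N}^2 \mid a \le b \text{ and there is a lattice polygon } \Delta' \simeq \Delta \text{ with } \Delta' \subset [0,a]\times[0,b] \}. \] Then $S_{1,1}(\Delta)$ has a minimum with respect to the product order on $\mathbb{N}^2$ (where $(a,b) \le (a',b')$ iff $a \le a'$ and $b \le b'$). This minimum is $(\mathrm{lw}(\Delta), \mathrm{ls}_\square(\Delta))$.
   Context: $\mathbb{N} = \{0,1,2,\dots\}$. A lattice polygon is the convex hull of finitely many points of $\mathbb{Z}^2$; it may be empty, a point or a segment. A unimodular transformation is an affine map $\mathbb{R}^2 \to \mathbb{R}^2$, $v \mapsto Av + w$, with $A \in \mathrm{GL}_2(\mathbb{Z})$ and $w \in \mathbb{Z}^2$. For lattice polygons, $\Delta \simeq \Delta'$ means $\Delta' = \varphi(\Delta)$ for some unimodular transformation $\varphi$. Let $\square = [0,1]^2$. For a non-empty lattice polygon $\Delta$: - the lattice size $\mathrm{ls}_\square(\Delta)$ is the smallest integer $d \ge 0$ such that $\varphi(\Delta) \subset d\square$ for some unimodular $\varphi$; - the lattice width $\mathrm{lw}(\Delta)$ is the smallest integer $d \ge 0$ such that $\varphi(\Delta) \subset [0,d] \times \mathbb{R}$ for some unimodular $\varphi$. *)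

theory Defs
  imports "HOL-Analysis.Analysis"
begin

definition lattice_points :: "(real^2) set" where
  "lattice_points = {x. \<forall>i. x $ i \<in> \<int>}"

definition lattice_polygon :: "(real^2) set \<Rightarrow> bool" where
  "lattice_polygon \<Delta> \<longleftrightarrow> (\<exists>F. finite F \<and> F \<subseteq> lattice_points \<and> \<Delta> = convex hull F)"

text \<open>Invertibility is taken over the integers, so \<open>A\<close> ranges over \<open>GL\<^sub>2(\<int>)\<close>.\<close>

definition unimodular :: "(real^2 \<Rightarrow> real^2) \<Rightarrow> bool" where
  "unimodular \<phi> \<longleftrightarrow>
     (\<exists>(A :: int^2^2) (w :: int^2). invertible A \<and>
        (\<forall>v. \<phi> v = map_matrix real_of_int A *v v + (\<chi> i. real_of_int (w $ i))))"

definition lattice_equivalent :: "(real^2) set \<Rightarrow> (real^2) set \<Rightarrow> bool" where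
  "lattice_equivalent \<Delta> \<Delta>' \<longleftrightarrow> (\<exists>\<phi>. unimodular \<phi> \<and> \<Delta>' = \<phi> ` \<Delta>)"

definition unit_square :: "(real^2) set" where
  "unit_square = cbox 0 (vector [1, 1])"

definition rectangle :: "nat \<Rightarrow> nat \<Rightarrow> (real^2) set" where
  "rectangle a b = cbox 0 (vector [real a, real b])"

definition strip :: "nat \<Rightarrow> (real^2) set" where
  "strip d = {x. x $ 1 \<in> {0..real d}}"

definition lattice_size_square :: "(real^2) set \<Rightarrow> nat" where
  "lattice_size_square \<Delta> =
     (LEAST d. \<exists>\<phi>. unimodular \<phi> \<and> \<phi> ` \<Delta> \<subseteq> (\<lambda>x. real d *\<^sub>R x) ` unit_square)"

definition lattice_width :: "(real^2) set \<Rightarrow> nat" where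
  "lattice_width \<Delta> = (LEAST d. \<exists>\<phi>. unimodular \<phi> \<and> \<phi> ` \<Delta> \<subseteq> strip d)"

definition S11 :: "(real^2) set \<Rightarrow> (nat \<times> nat) set" where
  "S11 \<Delta> = {(a, b). a \<le> b \<and>
     (\<exists>\<Delta>'. lattice_polygon \<Delta>' \<and> lattice_equivalent \<Delta> \<Delta>' \<and> \<Delta>' \<subseteq> rectangle a b)}"

text \<open>The order \<open>\<le>\<close> on pairs is the componentwise one of \<^theory>\<open>HOL-Library.Product_Order\<close>.\<close>

definition is_minimum :: "'a::order \<Rightarrow> 'a set \<Rightarrow> bool" where
  "is_minimum m S \<longleftrightarrow> m \<in> S \<and> (\<forall>p\<in>S. m \<le> p)"

end

theory Submission
  imports Defs
begin

text \<open>
  A unimodular map is a pair of integer functionals \<open>(u, v)\<close> forming a basis of the dual lattice,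
  together with a translation, so everything is governed by the width of \<open>\<Delta>\<close> along integer
  functionals, which is a seminorm. Choose \<open>u\<close> of minimal width \<open>lw(\<Delta>)\<close> among the primitive
  functionals, and \<open>v\<close> of minimal width among those completing \<open>u\<close> to a basis. A functional
  \<open>x = m u + n v\<close> with \<open>n \<noteq> 0\<close> can be written \<open>n (v + k u) + r u\<close> with \<open>2 \<bar>r\<bar> \<le> \<bar>n\<bar>\<close>, so
  \<open>width x \<ge> \<bar>n\<bar> width (v + k u) - \<bar>r\<bar> width u \<ge> (\<bar>n\<bar> - \<bar>r\<bar>) width v \<ge> width v\<close>.
  Every basis contains such an \<open>x\<close>, hence \<open>width v\<close> is the lattice size.
\<close>

section \<open>Integer functionals, determinants and widths\<close>

definition functional :: "int^2 \<Rightarrow> real^2 \<Rightarrow> real" where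
  "functional u x = of_int (u $ 1) * x $ 1 + of_int (u $ 2) * x $ 2"

definition det2 :: "int^2 \<Rightarrow> int^2 \<Rightarrow> int" where
  "det2 u v = u $ 1 * v $ 2 - u $ 2 * v $ 1"

text \<open>Meant for a finite set spanning the polygon: a linear functional varies as much over
  that set as over its hull, and \<open>Max\<close> wants finiteness.\<close>

definition width :: "(real^2) set \<Rightarrow> int^2 \<Rightarrow> real" where
  "width F u = Max ((\<lambda>(x, y). functional u x - functional u y) ` (F \<times> F))"

lemma functional_add: "functional (u + v) x = functional u x + functional v x"
  by (simp add: functional_def algebra_simps)

lemma functional_smult: "functional (c *s u) x = of_int c * functional u x"
  by (simp add: functional_def algebra_simps)

lemma functional_Ints: "x \<in> lattice_points \<Longrightarrow> functional u x \<in> \<int>"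
  by (auto simp: functional_def lattice_points_def)

section \<open>Unimodular maps as pairs of functionals\<close>

lemma invertible_int_2_iff:
  fixes A :: "int^2^2"
  shows "invertible A \<longleftrightarrow> \<bar>det2 (A $ 1) (A $ 2)\<bar> = 1"
proof
  assume "invertible A"
  then obtain B where "A ** B = mat 1"
    by (auto simp: invertible_def)
  then have "det A * det B = 1"
    by (metis det_I det_mul)
  then have "\<bar>det A\<bar> = 1"
    by (metis abs_zmult_eq_1 abs_1)
  then show "\<bar>det2 (A $ 1) (A $ 2)\<bar> = 1"
    by (simp add: det_2 det2_def mult.commute)
next
  define D where "D = det2 (A $ 1) (A $ 2)"
  assume "\<bar>det2 (A $ 1) (A $ 2)\<bar> = 1"
  then have D: "D * D = 1"
    by (auto simp: D_def abs_if split: if_splits)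
  \<comment> \<open>The adjugate divided by the determinant; since \<open>D * D = 1\<close>,
    dividing by \<open>D\<close> is multiplying by \<open>D\<close>.\<close>
  define B :: "int^2^2"
    where "B = vector [vector [D * A$2$2, - (D * A$1$2)], vector [- (D * A$2$1), D * A$1$1]]"
  have "A ** B = mat 1" "B ** A = mat 1"
    using D unfolding D_def det2_def
    by (simp_all add: vec_eq_iff forall_2 matrix_matrix_mult_def sum_2 B_def mat_def D_def det2_def
        algebra_simps)
  then show "invertible A"
    by (auto simp: invertible_def)
qed

text \<open>The two functionals are the rows of the matrix, so coordinates of the image can be
  treated one functional at a time.\<close>

lemma unimodular_iff:
  "unimodular \<phi> \<longleftrightarrow> (\<exists>u v s t. \<bar>det2 u v\<bar> = 1 \<and>
     (\<forall>x. \<phi> x = vector [functional u x + of_int s, functional v x + of_int t]))"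
proof
  assume "unimodular \<phi>"
  then obtain A :: "int^2^2" and w :: "int^2" where "invertible A"
    and "\<And>x. \<phi> x = map_matrix real_of_int A *v x + (\<chi> i. real_of_int (w $ i))"
    by (auto simp: unimodular_def)
  then show "\<exists>u v s t. \<bar>det2 u v\<bar> = 1 \<and>
     (\<forall>x. \<phi> x = vector [functional u x + of_int s, functional v x + of_int t])"
    by (intro exI[of _ "A $ 1"] exI[of _ "A $ 2"] exI[of _ "w $ 1"] exI[of _ "w $ 2"])
      (simp add: invertible_int_2_iff vec_eq_iff forall_2 matrix_vector_mult_def sum_2
        functional_def map_matrix_def)
next
  assume "\<exists>u v s t. \<bar>det2 u v\<bar> = 1 \<and>
     (\<forall>x. \<phi> x = vector [functional u x + of_int s, functional v x + of_int t])"
  then obtain u v s t where "\<bar>det2 u v\<bar> = 1"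
    and "\<And>x. \<phi> x = vector [functional u x + of_int s, functional v x + of_int t]"
    by auto
  then show "unimodular \<phi>"
    unfolding unimodular_def
    by (intro exI[of _ "vector [u, v]"] exI[of _ "vector [s, t]"])
      (simp add: invertible_int_2_iff vec_eq_iff forall_2 matrix_vector_mult_def sum_2
        functional_def map_matrix_def)
qed

lemma unimodular_image_convex_hull:
  assumes "unimodular \<phi>"
  shows "\<phi> ` (convex hull F) = convex hull (\<phi> ` F)"
proof -
  obtain A :: "int^2^2" and w :: "int^2" where
    \<phi>: "\<And>x. \<phi> x = map_matrix real_of_int A *v x + (\<chi> i. real_of_int (w $ i))"
    using assms by (auto simp: unimodular_def)
  define M where "M = (*v) (map_matrix real_of_int A)"
  define c where "c = (\<chi> i. real_of_int (w $ i))"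
  have "\<phi> = (+) c \<circ> M"
    using \<phi> by (auto simp: fun_eq_iff M_def c_def)
  then have image: "\<phi> ` X = (+) c ` (M ` X)" for X
    by (simp add: image_comp)
  have "linear M"
    by (simp add: M_def)
  then show ?thesis
    unfolding image by (simp add: convex_hull_translation convex_hull_linear_image)
qed

lemma unimodular_lattice_polygon:
  assumes "unimodular \<phi>" "lattice_polygon \<Delta>"
  shows "lattice_polygon (\<phi> ` \<Delta>)"
proof -
  obtain F where F: "finite F" "F \<subseteq> lattice_points" "\<Delta> = convex hull F"
    using assms by (auto simp: lattice_polygon_def)
  obtain u v s t where
    "\<And>x. \<phi> x = vector [functional u x + of_int s, functional v x + of_int t]"
    using assms by (auto simp: unimodular_iff)
  then have "\<phi> x \<in> lattice_points" if "x \<in> lattice_points" for x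
    using functional_Ints[OF that] by (simp add: lattice_points_def forall_2)
  then have "\<phi> ` F \<subseteq> lattice_points"
    using F(2) by blast
  then show ?thesis
    unfolding lattice_polygon_def F(3) unimodular_image_convex_hull[OF assms(1)]
    using F(1) by (intro exI[of _ "\<phi> ` F"]) simp
qed

section \<open>Squares, rectangles and strips\<close>

lemma mem_rectangle_iff: "x \<in> rectangle a b \<longleftrightarrow> x $ 1 \<in> {0..real a} \<and> x $ 2 \<in> {0..real b}"
  by (auto simp: rectangle_def mem_box_cart forall_2)

lemma scaled_unit_square: "(\<lambda>x. real d *\<^sub>R x) ` unit_square = rectangle d d"
proof -
  have "real d *\<^sub>R vector [1, 1] = (vector [real d, real d] :: real^2)"
    by (simp add: vec_eq_iff forall_2)
  \<comment> \<open>Shows the box non-empty, the case in which the scaling rule yields a box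
    again.\<close>
  moreover have "(vector [1, 1] :: real^2) \<in> cbox 0 (vector [1, 1])"
    by (simp add: mem_box_cart forall_2)
  ultimately show ?thesis
    unfolding unit_square_def rectangle_def
    by (subst image_smult_cbox) auto
qed

lemma convex_rectangle: "convex (rectangle a b)"
  by (simp add: rectangle_def)

lemma rectangle_mono: "a \<le> a' \<Longrightarrow> b \<le> b' \<Longrightarrow> rectangle a b \<subseteq> rectangle a' b'"
  by (auto simp: mem_rectangle_iff)

lemma rectangle_subset_strip: "rectangle a b \<subseteq> strip a"
  by (auto simp: mem_rectangle_iff strip_def)

section \<open>The width of a finite set as a seminorm\<close>

context
  fixes F :: "(real^2) set"
  assumes finite: "finite F" and nonempty: "F \<noteq> {}"
begin

lemma width_le_iff:
  "width F u \<le> d \<longleftrightarrow> (\<forall>x\<in>F. \<forall>y\<in>F. functional u x - functional u y \<le> d)"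
  unfolding width_def using finite nonempty by (subst Max_le_iff) auto

lemma functional_diff_le_width:
  "x \<in> F \<Longrightarrow> y \<in> F \<Longrightarrow> functional u x - functional u y \<le> width F u"
  using width_le_iff by blast

lemma width_attained: "\<exists>x\<in>F. \<exists>y\<in>F. width F u = functional u x - functional u y"
proof -
  have "width F u \<in> (\<lambda>(x, y). functional u x - functional u y) ` (F \<times> F)"
    unfolding width_def using finite nonempty by (intro Max_in) auto
  then show ?thesis by auto
qed

lemma width_nonneg: "0 \<le> width F u"
  using nonempty functional_diff_le_width by fastforce

lemma width_add_le: "width F (u + v) \<le> width F u + width F v"
proof -
  have "functional (u + v) x - functional (u + v) y \<le> width F u + width F v"
    if "x \<in> F" "y \<in> F" for x y
    using functional_diff_le_width[OF that, of u] functional_diff_le_width[OF that, of v]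
    by (simp add: functional_add)
  then show ?thesis by (simp add: width_le_iff)
qed

lemma width_smult_le: "width F (c *s u) \<le> \<bar>of_int c\<bar> * width F u"
proof -
  have "functional (c *s u) x - functional (c *s u) y \<le> \<bar>of_int c\<bar> * width F u"
    if "x \<in> F" "y \<in> F" for x y
  proof -
    have "\<bar>functional u x - functional u y\<bar> \<le> width F u"
      using functional_diff_le_width[OF that] functional_diff_le_width[OF that(2,1)]
      by (simp add: abs_le_iff)
    then have "\<bar>of_int c\<bar> * \<bar>functional u x - functional u y\<bar> \<le> \<bar>of_int c\<bar> * width F u"
      by (intro mult_left_mono) auto
    moreover have "functional (c *s u) x - functional (c *s u) y
      = of_int c * (functional u x - functional u y)"
      by (simp add: functional_smult algebra_simps)
    ultimately show ?thesis
      by (metis abs_ge_self abs_mult order_trans)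
  qed
  then show ?thesis by (simp add: width_le_iff)
qed

lemma width_smult: "width F (c *s u) = \<bar>of_int c\<bar> * width F u"
proof (rule antisym[OF width_smult_le])
  obtain x y where xy: "x \<in> F" "y \<in> F" "width F u = functional u x - functional u y"
    using width_attained by blast
  have "\<bar>of_int c\<bar> * width F u = functional (\<bar>c\<bar> *s u) x - functional (\<bar>c\<bar> *s u) y"
    by (simp add: xy(3) functional_smult right_diff_distrib)
  \<comment> \<open>For negative \<open>c\<close> the extremal pair is used in swapped
    order.\<close>
  also have "\<dots> \<le> width F (c *s u)"
    using functional_diff_le_width[OF xy(1,2), of "c *s u"]
      functional_diff_le_width[OF xy(2,1), of "c *s u"]
    by (cases "c \<ge> 0") (auto simp: functional_smult)
  finally show "\<bar>of_int c\<bar> * width F u \<le> width F (c *s u)" .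
qed

lemma width_eq_nat:
  assumes "F \<subseteq> lattice_points"
  obtains n where "width F u = real n"
proof -
  have "width F u \<in> \<int>"
    using width_attained[of u] assms by (auto intro!: Ints_diff functional_Ints)
  then show ?thesis
    using width_nonneg that by (metis Ints_cases of_int_0_le_iff of_int_of_nat_eq zero_le_imp_eq_int)
qed

text \<open>Gauss reduction in rank two: a \<open>v\<close> shortest in its coset modulo multiples
  of \<open>u\<close>, and no shorter than \<open>u\<close>, is shortest among all combinations that
  really involve \<open>v\<close>.\<close>

lemma width_reduced_basis_le:
  assumes uv: "width F u \<le> width F v"
    and min: "\<And>k. width F v \<le> width F (v + k *s u)"
    and "n \<noteq> 0"
  shows "width F v \<le> width F (m *s u + n *s v)"
proof -
  \<comment> \<open>Division with nearest-integer quotient, so the remainder \<open>r\<close> is at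
    most half of \<open>n\<close> in absolute value.\<close>
  define k where "k = round (of_int m / of_int n :: real)"
  define r where "r = m - n * k"
  have "real_of_int r = of_int n * (of_int m / of_int n - of_int k)"
    using \<open>n \<noteq> 0\<close> by (simp add: r_def field_simps)
  moreover have "\<bar>real_of_int m / of_int n - of_int k\<bar> \<le> 1 / 2"
    unfolding k_def using of_int_round_abs_le by (metis abs_minus_commute)
  ultimately have "\<bar>real_of_int r\<bar> \<le> \<bar>of_int n\<bar> * (1 / 2)"
    by (metis abs_mult abs_ge_zero mult_left_mono)
  then have "2 * \<bar>r\<bar> \<le> \<bar>n\<bar>"
    by linarith
  with \<open>n \<noteq> 0\<close> have "1 \<le> \<bar>n\<bar> - \<bar>r\<bar>"
    by linarith
  then have nr: "1 \<le> \<bar>real_of_int n\<bar> - \<bar>real_of_int r\<bar>"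
    by linarith
  have "n *s (v + k *s u) = (m *s u + n *s v) + (- r) *s u"
    by (simp add: vec_eq_iff r_def algebra_simps)
  then have "width F (n *s (v + k *s u)) \<le> width F (m *s u + n *s v) + width F ((- r) *s u)"
    by (metis width_add_le)
  then have "\<bar>of_int n\<bar> * width F (v + k *s u) \<le> width F (m *s u + n *s v) + \<bar>of_int r\<bar> * width F u"
    unfolding width_smult by simp
  moreover have "\<bar>of_int n\<bar> * width F v \<le> \<bar>of_int n\<bar> * width F (v + k *s u)"
    by (intro mult_left_mono min) auto
  moreover have "\<bar>of_int r\<bar> * width F u \<le> \<bar>of_int r\<bar> * width F v"
    by (intro mult_left_mono uv) auto
  ultimately have "(\<bar>of_int n\<bar> - \<bar>of_int r\<bar>) * width F v \<le> width F (m *s u + n *s v)"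
    by (simp add: algebra_simps)
  moreover have "1 * width F v \<le> (\<bar>of_int n\<bar> - \<bar>of_int r\<bar>) * width F v"
    by (intro mult_right_mono nr width_nonneg)
  ultimately show ?thesis
    by simp
qed

text \<open>The minimum of the functional is attained at a lattice point, hence is an integer, and
  shifting by its negative is allowed.\<close>

lemma translate_into_width:
  assumes "F \<subseteq> lattice_points"
  obtains s where "\<And>x. x \<in> F \<Longrightarrow> functional u x + of_int s \<in> {0..width F u}"
proof -
  obtain y where y: "y \<in> F" "functional u y = Min (functional u ` F)"
    using finite nonempty by (metis (no_types, lifting) Min_in finite_imageI image_iff image_is_empty)
  then obtain s where s: "functional u y = of_int s"
    using functional_Ints assms by (metis Ints_cases subsetD)
  show thesis
  proof (rule that[of "- s"])
    fix x assume "x \<in> F"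
    then show "functional u x + of_int (- s) \<in> {0..width F u}"
      using functional_diff_le_width[OF \<open>x \<in> F\<close> y(1), of u] s y(2) finite
        Min_le[of "functional u ` F" "functional u x"]
      by simp
  qed
qed

text \<open>Only the points of \<open>F\<close> need checking: unimodular maps commute with convex
  hulls and rectangles are convex.\<close>

lemma unimodular_into_rectangle:
  assumes "F \<subseteq> lattice_points" and "\<bar>det2 u v\<bar> = 1"
    and "width F u \<le> real a" and "width F v \<le> real b"
  obtains \<phi> where "unimodular \<phi>" "\<phi> ` (convex hull F) \<subseteq> rectangle a b"
proof -
  obtain s where s: "\<And>x. x \<in> F \<Longrightarrow> functional u x + of_int s \<in> {0..width F u}"
    using translate_into_width assms(1) by blast
  obtain t where t: "\<And>x. x \<in> F \<Longrightarrow> functional v x + of_int t \<in> {0..width F v}"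
    using translate_into_width assms(1) by blast
  define \<phi> :: "real^2 \<Rightarrow> real^2"
    where "\<phi> x = vector [functional u x + of_int s, functional v x + of_int t]" for x
  have "unimodular \<phi>"
    using assms(2) unfolding unimodular_iff \<phi>_def by blast
  moreover have "\<phi> x \<in> rectangle a b" if "x \<in> F" for x
    using s[OF that] t[OF that] assms(3,4) by (simp add: mem_rectangle_iff \<phi>_def)
  then have "\<phi> ` F \<subseteq> rectangle a b"
    by blast
  then have "convex hull (\<phi> ` F) \<subseteq> rectangle a b"
    by (intro hull_minimal convex_rectangle)
  ultimately show ?thesis
    using that unimodular_image_convex_hull by metis
qed

text \<open>The translation cancels in differences. The index \<open>i\<close> lets this serve both
  coordinates.\<close>

lemma width_le_of_strip:
  assumes "\<And>x. \<phi> x $ i = functional u x + of_int s"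
    and "\<And>x. x \<in> F \<Longrightarrow> \<phi> x $ i \<in> {0..d}"
  shows "width F u \<le> d"
proof -
  have "functional u x - functional u y \<le> d" if "x \<in> F" "y \<in> F" for x y
    using assms(2)[OF that(1)] assms(2)[OF that(2)] by (simp add: assms(1))
  then show ?thesis by (simp add: width_le_iff)
qed

end

section \<open>Bases of the dual lattice\<close>

lemma det2_commute: "det2 u v = - det2 v u"
  by (simp add: det2_def)

lemma det2_add_smult: "det2 u (v + k *s u) = det2 u v"
  by (simp add: det2_def algebra_simps)

text \<open>Cramer's rule; the determinant is its own inverse, so it appears as a factor instead of
  a divisor.\<close>

lemma basis_expansion:
  assumes "\<bar>det2 u v\<bar> = 1"
  shows "x = (det2 u v * det2 x v) *s u + (det2 u v * det2 u x) *s v"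
proof -
  define D where "D = det2 u v"
  have D: "D * D = 1"
    using assms by (auto simp: D_def abs_if split: if_splits)
  have "(D * det2 x v) * u $ i + (D * det2 u x) * v $ i = (D * D) * x $ i" for i
  proof -
    have "det2 x v * u $ i + det2 u x * v $ i = D * x $ i"
      using exhaust_2[of i] by (auto simp: D_def det2_def algebra_simps)
    then show ?thesis
      by (simp add: mult.assoc flip: distrib_left)
  qed
  then show ?thesis
    unfolding D_def[symmetric] by (simp add: vec_eq_iff D)
qed

text \<open>Otherwise \<open>u'\<close> and \<open>v'\<close> would both be multiples of
  \<open>u\<close> and have determinant zero. This finds in every basis a functional transverse to
  \<open>u\<close>.\<close>

lemma basis_not_parallel:
  assumes "\<bar>det2 u v\<bar> = 1" "\<bar>det2 u' v'\<bar> = 1"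
  shows "det2 u u' \<noteq> 0 \<or> det2 u v' \<noteq> 0"
proof (rule ccontr)
  assume "\<not> ?thesis"
  then have "u' = (det2 u v * det2 u' v) *s u" "v' = (det2 u v * det2 v' v) *s u"
    using basis_expansion[OF assms(1), of u'] basis_expansion[OF assms(1), of v'] by simp_all
  moreover have "det2 (m *s u) (n *s u) = 0" for m n
    by (simp add: det2_def)
  ultimately have "det2 u' v' = 0"
    by metis
  with assms(2) show False by simp
qed

section \<open>Lattice width, lattice size and the minimum\<close>

theorem theorem1:
  fixes \<Delta> :: "(real^2) set"
  assumes "lattice_polygon \<Delta>" and "\<Delta> \<noteq> {}"
  shows "is_minimum (lattice_width \<Delta>, lattice_size_square \<Delta>) (S11 \<Delta>)"
proof -
  obtain F where F: "finite F" "F \<subseteq> lattice_points" "\<Delta> = convex hull F"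
    using assms(1) by (auto simp: lattice_polygon_def)
  have ne: "F \<noteq> {}"
    using assms(2) F by auto
  note width_rules = F(1) ne
  have F_sub: "F \<subseteq> \<Delta>"
    by (simp add: F(3) hull_subset)
  have into_rectangle: "\<exists>\<phi>. unimodular \<phi> \<and> \<phi> ` \<Delta> \<subseteq> rectangle a b"
    if "\<bar>det2 u v\<bar> = 1" "width F u \<le> real a" "width F v \<le> real b" for u v a b
    using unimodular_into_rectangle[OF width_rules F(2) that] F(3) by metis

  have lw_le: "lattice_width \<Delta> \<le> d" if "unimodular \<phi>" "\<phi> ` \<Delta> \<subseteq> strip d" for \<phi> d
    unfolding lattice_width_def using that by (intro Least_le) blast
  have ls_le: "lattice_size_square \<Delta> \<le> d" if "unimodular \<phi>" "\<phi> ` \<Delta> \<subseteq> rectangle d d" for \<phi> d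
    unfolding lattice_size_square_def scaled_unit_square using that by (intro Least_le) blast
  \<comment> \<open>The partner \<open>y\<close> expresses that \<open>x\<close> is primitive;
    forgetting the second coordinate of the rectangle leaves a strip.\<close>
  have lw_le_width: "real (lattice_width \<Delta>) \<le> width F x" if xy: "\<bar>det2 x y\<bar> = 1" for x y
  proof -
    obtain a b where ab: "width F x = real a" "width F y = real b"
      using width_eq_nat[OF width_rules F(2)] by metis
    then obtain \<phi> where "unimodular \<phi>" "\<phi> ` \<Delta> \<subseteq> rectangle a b"
      using into_rectangle[OF xy, of a b] by auto
    then have "lattice_width \<Delta> \<le> a"
      using lw_le rectangle_subset_strip by (meson order_trans)
    then show ?thesis
      by (simp add: ab)
  qed

  \<comment> \<open>A witness from the standard basis, so that both \<open>LEAST\<close> values are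
    attained.\<close>
  have ex_rectangle: "\<exists>d. \<exists>\<phi>. unimodular \<phi> \<and> \<phi> ` \<Delta> \<subseteq> rectangle d d"
  proof -
    define e1 e2 :: "int^2" where "e1 = vector [1, 0]" and "e2 = vector [0, 1]"
    obtain a b where "width F e1 = real a" "width F e2 = real b"
      using width_eq_nat[OF width_rules F(2)] by metis
    moreover have "\<bar>det2 e1 e2\<bar> = 1"
      by (simp add: e1_def e2_def det2_def)
    ultimately show ?thesis
      using into_rectangle[of e1 e2 "max a b" "max a b"] by auto
  qed
  then have "\<exists>d. \<exists>\<phi>. unimodular \<phi> \<and> \<phi> ` \<Delta> \<subseteq> strip d"
    using rectangle_subset_strip by (meson order_trans)
  then have "\<exists>\<phi>. unimodular \<phi> \<and> \<phi> ` \<Delta> \<subseteq> strip (lattice_width \<Delta>)"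
    unfolding lattice_width_def by (rule LeastI_ex)
  then obtain \<phi> where \<phi>: "unimodular \<phi>" "\<phi> ` \<Delta> \<subseteq> strip (lattice_width \<Delta>)"
    by blast
  then obtain u v0 s t where uv0: "\<bar>det2 u v0\<bar> = 1"
    and \<phi>_eq: "\<And>x. \<phi> x = vector [functional u x + of_int s, functional v0 x + of_int t]"
    by (auto simp: unimodular_iff)
  have "width F u \<le> real (lattice_width \<Delta>)"
  proof (rule width_le_of_strip[OF width_rules])
    show "\<phi> x $ 1 = functional u x + of_int s" for x
      by (simp add: \<phi>_eq)
    show "\<phi> x $ 1 \<in> {0..real (lattice_width \<Delta>)}" if "x \<in> F" for x
      using that \<phi>(2) F_sub by (auto simp: strip_def)
  qed
  with lw_le_width[OF uv0] have width_u: "width F u = real (lattice_width \<Delta>)"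
    by simp

  \<comment> \<open>Widths are natural numbers, so \<open>nat\<close> of the floor loses nothing and
    a least value exists. The competitors include every \<open>v + k *s u\<close>, which has the
    same determinant with \<open>u\<close>.\<close>
  obtain v where uv: "\<bar>det2 u v\<bar> = 1"
    and v_min: "\<And>v'. \<bar>det2 u v'\<bar> = 1 \<Longrightarrow> nat \<lfloor>width F v\<rfloor> \<le> nat \<lfloor>width F v'\<rfloor>"
    using ex_has_least_nat[of "\<lambda>v. \<bar>det2 u v\<bar> = 1" v0 "\<lambda>v. nat \<lfloor>width F v\<rfloor>"] uv0 by blast
  obtain b where width_v: "width F v = real b"
    using width_eq_nat[OF width_rules F(2)] by metis
  have v_min': "width F v \<le> width F (v + k *s u)" for k
  proof -
    obtain c where "width F (v + k *s u) = real c"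
      using width_eq_nat[OF width_rules F(2)] by metis
    then show ?thesis
      using v_min[of "v + k *s u"] uv by (simp add: det2_add_smult width_v)
  qed
  \<comment> \<open>\<open>v\<close> is primitive too, with partner \<open>u\<close>, so its width
    is at least the lattice width.\<close>
  have "width F u \<le> width F v"
    using lw_le_width[of v u] uv width_u by (simp add: det2_commute[of v u])
  \<comment> \<open>Up to sign, \<open>det2 u x\<close> is the coefficient of \<open>v\<close> in
    \<open>x\<close>.\<close>
  then have transverse: "width F v \<le> width F x" if "det2 u x \<noteq> 0" for x
    using width_reduced_basis_le[OF width_rules _ v_min', of "det2 u v * det2 u x"
        "det2 u v * det2 x v"] that uv basis_expansion[OF uv, of x] by auto

  have lw_le_b: "lattice_width \<Delta> \<le> b"
    using \<open>width F u \<le> width F v\<close> width_u width_v by simp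
  \<comment> \<open>A single map attains both values at once; it gives membership in
    \<open>S11\<close> as well as the upper bound on the lattice size.\<close>
  obtain \<psi> where \<psi>: "unimodular \<psi>" "\<psi> ` \<Delta> \<subseteq> rectangle (lattice_width \<Delta>) b"
    using into_rectangle[OF uv, of "lattice_width \<Delta>" b] width_u width_v by auto
  have "lattice_size_square \<Delta> = b"
  proof (rule antisym)
    show "lattice_size_square \<Delta> \<le> b"
      using \<psi>(2) rectangle_mono[OF lw_le_b order_refl] by (intro ls_le[OF \<psi>(1)]) (rule order_trans)
    let ?l = "lattice_size_square \<Delta>"
    have "\<exists>\<phi>. unimodular \<phi> \<and> \<phi> ` \<Delta> \<subseteq> rectangle ?l ?l"
      using ex_rectangle unfolding lattice_size_square_def scaled_unit_square by (rule LeastI_ex)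
    then obtain \<theta> where \<theta>: "unimodular \<theta>" "\<theta> ` \<Delta> \<subseteq> rectangle ?l ?l"
      by blast
    then obtain u' v' s' t' where uv': "\<bar>det2 u' v'\<bar> = 1"
      and \<theta>_eq: "\<And>x. \<theta> x = vector [functional u' x + of_int s', functional v' x + of_int t']"
      by (auto simp: unimodular_iff)
    have in_rect: "\<theta> x \<in> rectangle ?l ?l" if "x \<in> F" for x
      using that \<theta>(2) F_sub by auto
    have "width F u' \<le> real ?l"
      by (rule width_le_of_strip[OF width_rules, where \<phi> = \<theta> and i = 1 and s = s'])
        (use in_rect in \<open>auto simp: mem_rectangle_iff \<theta>_eq\<close>)
    moreover have "width F v' \<le> real ?l"
      by (rule width_le_of_strip[OF width_rules, where \<phi> = \<theta> and i = 2 and s = t'])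
        (use in_rect in \<open>auto simp: mem_rectangle_iff \<theta>_eq\<close>)
    \<comment> \<open>One of \<open>u'\<close>, \<open>v'\<close> is transverse to \<open>u\<close>,
      so its width is at least \<open>b\<close>.\<close>
    ultimately show "b \<le> ?l"
      using basis_not_parallel[OF uv uv'] transverse[of u'] transverse[of v'] width_v by auto
  qed
  then have "(lattice_width \<Delta>, lattice_size_square \<Delta>) \<in> S11 \<Delta>"
    using \<psi> lw_le_b unimodular_lattice_polygon[OF \<psi>(1) assms(1)]
    by (auto simp: S11_def lattice_equivalent_def)
  moreover have "(lattice_width \<Delta>, lattice_size_square \<Delta>) \<le> p" if p: "p \<in> S11 \<Delta>" for p
  proof -
    obtain a c \<phi> where "p = (a, c)" "a \<le> c" "unimodular \<phi>" "\<phi> ` \<Delta> \<subseteq> rectangle a c"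
      using p by (auto simp: S11_def lattice_equivalent_def)
    moreover from this have "lattice_width \<Delta> \<le> a"
      using lw_le rectangle_subset_strip by (meson order_trans)
    \<comment> \<open>Here \<open>a \<le> c\<close> matters: the rectangle fits in the square of
      side \<open>c\<close>.\<close>
    moreover have "lattice_size_square \<Delta> \<le> c"
      using \<open>\<phi> ` \<Delta> \<subseteq> _\<close> rectangle_mono[OF \<open>a \<le> c\<close> order_refl]
      by (intro ls_le[OF \<open>unimodular \<phi>\<close>]) (rule order_trans)
    ultimately show ?thesis by simp
  qed
  ultimately show ?thesis
    by (simp add: is_minimum_def)
qed

end
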